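(* Assume that solving the eigenvalue problems in the coarse spaces $V_H$ and $V_{h_1}$ needs work $\mathcal{O}(M_H)$ and $\mathcal{O}(M_{h_1})$, respectively, and that the work of the multigrid solver $MG(V_{h_k},\lambda_{\ell,h_k}u_{\ell,h_k},u_{\ell,h_k},m)$ in each level space $V_{h_k}$ is $\mathcal{O}(N_k)$ for $k=2,3,\dots,n$, where $N_k=\dim V_{h_k}$. Then the work involved in the full multigrid scheme (described in the context) is $$\mathcal{O}\big(N_n+M_H\log(N_n)+M_{h_1}\big).$$ Furthermore, the complexity is $\mathcal{O}(N_n)$ provided $M_H\ll N_k$ and $M_{h_1}\le N_k$ for $k=2,\dots,n$.
   Context: Setting. $\Omega\subset\mathbb{R}^d$ ($d=2,3$) is a bounded domain with Lipschitz boundary, $V=H_0^1(\Omega)$, $\mathcal{A}$ is a symmetric positive definite matrix with suitable regularity, $\phi\ge 0$ is a function on $\Omega$, and $$a(u,v)=\int_\Omega(\nabla u\cdot\mathcal{A}\nabla v+\phi uv)\,d\Omega,\qquad b(u,v)=\int_\Omega uv\,d\Omega.$$ The eigenvalue problem is: find $(\lambda,u)\in\mathbb{R}\times V$ with $b(u,u)=1$ and $a(u,v)=\lambda b(u,v)$ for all $v\in V$. Finite element spaces. $\mathcal{T}_H$ is a coarse shape-regular mesh of $\Omega$ with mesh size $H$ and $V_H\subset V$ is the corresponding linear finite element space. $\mathcal{T}_{h_1}$ is produced from $\mathcal{T}_H$ by regular refinements, and $\mathcal{T}_{h_k}$ is obtained from $\mathcal{T}_{h_{k-1}}$ by one regular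 refinement (each cell is divided into $\beta^d$ subelements), so $h_k=h_{k-1}/\beta$ for $k=2,\dots,n$, where $\beta>1$ (always equal to $2$). The corresponding linear finite element spaces are nested: $V_H\subseteq V_{h_1}\subset\cdots\subset V_{h_n}$, and their dimensions $N_k=\dim V_{h_k}$ satisfy $$N_k=\Big(\frac1\beta\Big)^{d(n-k)}N_n,\qquad k=1,\dots,n.$$ One correction step $(\lambda_{\ell+1,h_k},u_{\ell+1,h_k})=EigenMG(V_H,\lambda_{\ell,h_k},u_{\ell,h_k},V_{h_k},m)$: (1) Perform $m$ multigrid iteration steps, with initial value $u_{\ell,h_k}$, for the linear problem: find $\widehat u_{\ell+1,h_k}\in V_{h_k}$ such that $a(\widehat u_{\ell+1,h_k},v)=\lambda_{\ell,h_k}b(u_{\ell,h_k},v)$ for all $v\in V_{h_k}$; the result is $\widetilde u_{\ell+1,h_k}=MG(V_{h_k},\lambda_{\ell,h_k}u_{\ell,h_k},u_{\ell,h_k},m)\in V_{h_k}$. (2) Set $V_{H,h_k}=V_H+\mathrm{span}\{\widetilde u_{\ell+1,h_k}\}$ and solve the eigenvalue problem in this space: find $(\lambda_{\ell+1,h_k},u_{\ell+1,h_k})\in\mathbb{R}\times V_{H,h_k}$ with $b(u_{\ell+1,h_k},u_{\ell+1,h_k})=1$ and $a(u_{\ell+1,h_k},v)=\lambda_{\ell+1,h_k}b(u_{\ell+1,h_k},v)$ for all $v\in V_{H,h_k}$. The work of this coarse solve (whose dimension exceeds $\dim V_H$ by at most one) is counted as $\mathcal{O}(M_H)$. Full multigrid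 scheme: 1. Solve the eigenvalue problem in $V_{h_1}$: find $(\lambda_{h_1},u_{h_1})\in\mathbb{R}\times V_{h_1}$ with $a(u_{h_1},v)=\lambda_{h_1}b(u_{h_1},v)$ for all $v\in V_{h_1}$. 2. For $k=2,\dots,n$: set $u_{0,h_k}=u_{h_{k-1}}$ and $\lambda_{0,h_k}=\lambda_{h_{k-1}}$; for $\ell=0,\dots,p-1$ compute $(\lambda_{\ell+1,h_k},u_{\ell+1,h_k})=EigenMG(V_H,\lambda_{\ell,h_k},u_{\ell,h_k},V_{h_k},m)$; set $\lambda_{h_k}=\lambda_{p,h_k}$ and $u_{h_k}=u_{p,h_k}$. The output is $(\lambda_{h_n},u_{h_n})$. The numbers $m$, $p$, $\beta$, $d$ are fixed, and the constants in $\mathcal{O}(\cdot)$ do not depend on the level $k$ or the number of levels $n$. The notation $M_H\ll N_k$ means that $M_H$ is much smaller than $N_k$ (in particular $M_H\le N_k$). *)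

theory Defs
  imports "HOL-Analysis.Analysis" "HOL-Library.Function_Algebras" "HOL-Library.Landau_Symbols"
begin

section \<open>Functions on the domain\<close>

text \<open>Scalar functions form a real vector space with the pointwise addition of
  Function_Algebras and the following scaling; \<open>fn.subspace\<close>, \<open>fn.span\<close>, \<open>fn.dim\<close> are the
  library notions for this space.\<close>

type_synonym 'd fn = "real ^ 'd \<Rightarrow> real"

definition fscale :: "real \<Rightarrow> ('a \<Rightarrow> real) \<Rightarrow> 'a \<Rightarrow> real" where
  "fscale c f = (\<lambda>x. c * f x)"

interpretation fn: vector_space fscale
  by unfold_locales (auto simp: fscale_def fun_eq_iff algebra_simps)

definition partial :: "'d \<Rightarrow> ('d::finite) fn \<Rightarrow> 'd fn" where
  "partial j f = (\<lambda>x. frechet_derivative f (at x) (axis j 1))"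

primrec k_times_cont_diff :: "nat \<Rightarrow> ('d::finite) fn \<Rightarrow> bool" where
  "k_times_cont_diff 0 f \<longleftrightarrow> continuous_on UNIV f"
| "k_times_cont_diff (Suc k) f \<longleftrightarrow>
     (\<forall>x. f differentiable (at x)) \<and> (\<forall>j. k_times_cont_diff k (partial j f))"

definition test_function :: "(real ^ 'd) set \<Rightarrow> ('d::finite) fn \<Rightarrow> bool" where
  "test_function \<Omega> f \<longleftrightarrow>
     (\<forall>k. k_times_cont_diff k f) \<and> compact (closure {x. f x \<noteq> 0}) \<and> closure {x. f x \<noteq> 0} \<subseteq> \<Omega>"

definition square_integrable :: "(real ^ 'd) set \<Rightarrow> ('d::finite) fn \<Rightarrow> bool" where
  "square_integrable \<Omega> u \<longleftrightarrow>
     set_borel_measurable lebesgue \<Omega> u \<and> set_integrable lebesgue \<Omega> (\<lambda>x. (u x)\<^sup>2)"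

definition weak_gradient ::
  "(real ^ 'd) set \<Rightarrow> ('d::finite) fn \<Rightarrow> (real ^ 'd \<Rightarrow> real ^ 'd) \<Rightarrow> bool" where
  "weak_gradient \<Omega> u g \<longleftrightarrow>
     (\<forall>j. square_integrable \<Omega> (\<lambda>x. g x $ j)) \<and>
     (\<forall>\<psi> j. test_function \<Omega> \<psi> \<longrightarrow>
        (LINT x:\<Omega>|lebesgue. u x * partial j \<psi> x) = - (LINT x:\<Omega>|lebesgue. g x $ j * \<psi> x))"

definition H1 :: "(real ^ 'd) set \<Rightarrow> ('d::finite) fn set" where
  "H1 \<Omega> = {u. square_integrable \<Omega> u \<and> (\<exists>g. weak_gradient \<Omega> u g)}"

text \<open>Weak gradients are unique up to null sets, so the choice below does not influence
  any integral.\<close>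

definition grad :: "(real ^ 'd) set \<Rightarrow> ('d::finite) fn \<Rightarrow> real ^ 'd \<Rightarrow> real ^ 'd" where
  "grad \<Omega> u = (SOME g. weak_gradient \<Omega> u g)"

definition H1_norm :: "(real ^ 'd) set \<Rightarrow> ('d::finite) fn \<Rightarrow> real" where
  "H1_norm \<Omega> u = sqrt (LINT x:\<Omega>|lebesgue. (u x)\<^sup>2 + (norm (grad \<Omega> u x))\<^sup>2)"

definition H1_0 :: "(real ^ 'd) set \<Rightarrow> ('d::finite) fn set" where
  "H1_0 \<Omega> = {u \<in> H1 \<Omega>. \<exists>\<psi>. (\<forall>k. test_function \<Omega> (\<psi> k)) \<and>
                               (\<lambda>k. H1_norm \<Omega> (u - \<psi> k)) \<longlonglongrightarrow> 0}"

text \<open>A bounded domain that is locally, in suitable orthonormal coordinates whose last axis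
  is \<open>e\<close>, the strict epigraph of a Lipschitz function. The function \<open>\<gamma>\<close> of the remaining
  coordinates is written as a function on the whole space that is constant along \<open>e\<close>.\<close>

definition bounded_lipschitz_domain :: "(real ^ 'd) set \<Rightarrow> bool" where
  "bounded_lipschitz_domain \<Omega> \<longleftrightarrow>
     open \<Omega> \<and> connected \<Omega> \<and> bounded \<Omega> \<and> \<Omega> \<noteq> {} \<and>
     (\<forall>x\<in>frontier \<Omega>. \<exists>U e \<gamma> L.
        open U \<and> x \<in> U \<and> norm e = 1 \<and> L-lipschitz_on UNIV \<gamma> \<and>
        (\<forall>y t. \<gamma> (y + t *\<^sub>R e) = \<gamma> y) \<and>
        \<Omega> \<inter> U = {y \<in> U. \<gamma> y < y \<bullet> e})"

definition admissible_coefficients ::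
  "(real ^ 'd) set \<Rightarrow> (real ^ 'd \<Rightarrow> real ^ 'd ^ 'd) \<Rightarrow> ('d::finite) fn \<Rightarrow> bool" where
  "admissible_coefficients \<Omega> A \<phi> \<longleftrightarrow>
     (\<forall>i j. set_borel_measurable lebesgue \<Omega> (\<lambda>x. A x $ i $ j)) \<and>
     (\<exists>B. \<forall>x\<in>\<Omega>. \<forall>i j. \<bar>A x $ i $ j\<bar> \<le> B) \<and>
     (\<forall>x\<in>\<Omega>. transpose (A x) = A x \<and> (\<forall>\<xi>. \<xi> \<noteq> 0 \<longrightarrow> 0 < \<xi> \<bullet> (A x *v \<xi>))) \<and>
     set_borel_measurable lebesgue \<Omega> \<phi> \<and>
     (\<exists>B. \<forall>x\<in>\<Omega>. \<phi> x \<le> B) \<and>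
     (\<forall>x\<in>\<Omega>. 0 \<le> \<phi> x)"

definition form_a :: "(real ^ 'd) set \<Rightarrow> (real ^ 'd \<Rightarrow> real ^ 'd ^ 'd) \<Rightarrow> ('d::finite) fn
    \<Rightarrow> 'd fn \<Rightarrow> 'd fn \<Rightarrow> real" where
  "form_a \<Omega> A \<phi> u v =
     (LINT x:\<Omega>|lebesgue. grad \<Omega> u x \<bullet> (A x *v grad \<Omega> v x) + \<phi> x * u x * v x)"

definition form_b :: "(real ^ 'd) set \<Rightarrow> ('d::finite) fn \<Rightarrow> 'd fn \<Rightarrow> real" where
  "form_b \<Omega> u v = (LINT x:\<Omega>|lebesgue. u x * v x)"

text \<open>The eigenvalue problem in a subspace \<open>W\<close> of \<open>H1_0 \<Omega>\<close>.\<close>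

definition eigenpair_in :: "(real ^ 'd) set \<Rightarrow> (real ^ 'd \<Rightarrow> real ^ 'd ^ 'd) \<Rightarrow> ('d::finite) fn
    \<Rightarrow> 'd fn set \<Rightarrow> real \<times> 'd fn \<Rightarrow> bool" where
  "eigenpair_in \<Omega> A \<phi> W = (\<lambda>(lam, u).
     u \<in> W \<and> form_b \<Omega> u u = 1 \<and> (\<forall>v\<in>W. form_a \<Omega> A \<phi> u v = lam * form_b \<Omega> u v))"


section \<open>Meshes and linear finite element spaces\<close>

definition mesh :: "(real ^ 'd) set \<Rightarrow> (real ^ 'd) set set \<Rightarrow> bool" where
  "mesh \<Omega> \<T> \<longleftrightarrow>
     triangulation \<T> \<and> (\<forall>K\<in>\<T>. int CARD('d) simplex K) \<and> \<Union>\<T> = closure \<Omega>"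

definition mesh_size :: "(real ^ 'd) set set \<Rightarrow> real" where
  "mesh_size \<T> = Max (diameter ` \<T>)"

definition shape_regular :: "real \<Rightarrow> (real ^ 'd) set set \<Rightarrow> bool" where
  "shape_regular \<sigma> \<T> \<longleftrightarrow> (\<forall>K\<in>\<T>. \<exists>x. cball x (diameter K / \<sigma>) \<subseteq> K)"

definition regular_refinement ::
  "(real ^ 'd) set \<Rightarrow> nat \<Rightarrow> (real ^ 'd) set set \<Rightarrow> (real ^ 'd) set set \<Rightarrow> bool" where
  "regular_refinement \<Omega> \<beta> \<T> \<T>' \<longleftrightarrow>
     mesh \<Omega> \<T> \<and> mesh \<Omega> \<T>' \<and>
     (\<forall>K'\<in>\<T>'. \<exists>K\<in>\<T>. K' \<subseteq> K) \<and>
     (\<forall>K\<in>\<T>. K = \<Union>{K'\<in>\<T>'. K' \<subseteq> K} \<and> card {K'\<in>\<T>'. K' \<subseteq> K} = \<beta> ^ CARD('d))"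

text \<open>Continuous, piecewise affine functions with zero boundary values. They are extended by
  zero outside \<open>\<Omega>\<close>, so that each finite element function has exactly one representative and
  \<open>fn.dim\<close> is the dimension of the finite element space.\<close>

definition linear_fe_space :: "(real ^ 'd) set \<Rightarrow> (real ^ 'd) set set \<Rightarrow> ('d::finite) fn set" where
  "linear_fe_space \<Omega> \<T> =
     {u. continuous_on UNIV u \<and> (\<forall>x. x \<notin> \<Omega> \<longrightarrow> u x = 0) \<and>
         (\<forall>K\<in>\<T>. \<exists>c g. \<forall>x\<in>K. u x = c + g \<bullet> x)}"


section \<open>The full multigrid scheme with its work\<close>

text \<open>One run of the scheme is determined by the coarse mesh, the number of levels, the meshes
  \<open>level_mesh _ k\<close> for \<open>k = 1, \<dots>, levels\<close>, a solver for eigenvalue problems in subspaces, and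
  one multigrid iteration step. The step takes the space \<open>W\<close>, the datum \<open>g\<close> of the linear
  problem \<open>a(w,v) = b(g,v)\<close> for all \<open>v \<in> W\<close>, and the current iterate.
  Every solver returns its result together with the number of operations spent.\<close>

type_synonym 'a costed = "'a \<times> nat"

record ('d::finite) fmg =
  coarse_mesh :: "(real ^ 'd) set set"
  levels :: nat
  level_mesh :: "nat \<Rightarrow> (real ^ 'd) set set"
  eig_solver :: "'d fn set \<Rightarrow> (real \<times> 'd fn) costed"
  mg_step :: "'d fn set \<Rightarrow> 'd fn \<Rightarrow> 'd fn \<Rightarrow> 'd fn costed"

definition V_H :: "(real ^ 'd) set \<Rightarrow> ('d::finite) fmg \<Rightarrow> 'd fn set" where
  "V_H \<Omega> S = linear_fe_space \<Omega> (coarse_mesh S)"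

definition V_h :: "(real ^ 'd) set \<Rightarrow> ('d::finite) fmg \<Rightarrow> nat \<Rightarrow> 'd fn set" where
  "V_h \<Omega> S k = linear_fe_space \<Omega> (level_mesh S k)"

definition N_dof :: "(real ^ 'd) set \<Rightarrow> ('d::finite) fmg \<Rightarrow> nat \<Rightarrow> nat" where
  "N_dof \<Omega> S k = fn.dim (V_h \<Omega> S k)"

primrec MG :: "('d::finite) fmg \<Rightarrow> 'd fn set \<Rightarrow> 'd fn \<Rightarrow> 'd fn \<Rightarrow> nat \<Rightarrow> 'd fn costed" where
  "MG S W g u 0 = (u, 0)"
| "MG S W g u (Suc m) =
     (let (u', c) = MG S W g u m;
          (u'', c') = mg_step S W g u'
      in (u'', c + c'))"

definition V_Hh :: "(real ^ 'd) set \<Rightarrow> ('d::finite) fmg \<Rightarrow> 'd fn \<Rightarrow> 'd fn set" where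
  "V_Hh \<Omega> S w = {v + y |v y. v \<in> V_H \<Omega> S \<and> y \<in> fn.span {w}}"

definition EigenMG :: "(real ^ 'd) set \<Rightarrow> nat \<Rightarrow> ('d::finite) fmg \<Rightarrow> nat
    \<Rightarrow> real \<times> 'd fn \<Rightarrow> (real \<times> 'd fn) costed" where
  "EigenMG \<Omega> m S k = (\<lambda>(lam, u).
     let (w, c) = MG S (V_h \<Omega> S k) (fscale lam u) u m;
         (r, c') = eig_solver S (V_Hh \<Omega> S w)
     in (r, c + c'))"

primrec corrections :: "(real ^ 'd) set \<Rightarrow> nat \<Rightarrow> ('d::finite) fmg \<Rightarrow> nat
    \<Rightarrow> real \<times> 'd fn \<Rightarrow> nat \<Rightarrow> (real \<times> 'd fn) costed" where
  "corrections \<Omega> m S k r 0 = (r, 0)"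
| "corrections \<Omega> m S k r (Suc l) =
     (let (r', c) = corrections \<Omega> m S k r l;
          (r'', c') = EigenMG \<Omega> m S k r'
      in (r'', c + c'))"

text \<open>The pair \<open>(\<lambda>, u)\<close> after level \<open>k \<ge> 1\<close>, with the work spent on levels \<open>1, \<dots>, k\<close>.\<close>

fun fmg_upto :: "(real ^ 'd) set \<Rightarrow> nat \<Rightarrow> nat \<Rightarrow> ('d::finite) fmg \<Rightarrow> nat
    \<Rightarrow> (real \<times> 'd fn) costed" where
  "fmg_upto \<Omega> m p S k =
     (if k \<le> 1 then eig_solver S (V_h \<Omega> S 1)
      else let (r, c) = fmg_upto \<Omega> m p S (k - 1);
               (r', c') = corrections \<Omega> m S k r p
           in (r', c + c'))"

declare fmg_upto.simps [simp del]

definition full_multigrid :: "(real ^ 'd) set \<Rightarrow> nat \<Rightarrow> nat \<Rightarrow> ('d::finite) fmg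
    \<Rightarrow> (real \<times> 'd fn) costed" where
  "full_multigrid \<Omega> m p S = fmg_upto \<Omega> m p S (levels S)"

definition fmg_work :: "(real ^ 'd) set \<Rightarrow> nat \<Rightarrow> nat \<Rightarrow> ('d::finite) fmg \<Rightarrow> nat" where
  "fmg_work \<Omega> m p S = snd (full_multigrid \<Omega> m p S)"

text \<open>The iterate \<open>(\<lambda>\<^sub>l, u\<^sub>l)\<close> on level \<open>k \<ge> 2\<close>, and the multigrid call and the coarse eigenvalue
  solve that produce the next one.\<close>

definition iterate :: "(real ^ 'd) set \<Rightarrow> nat \<Rightarrow> nat \<Rightarrow> ('d::finite) fmg \<Rightarrow> nat \<Rightarrow> nat
    \<Rightarrow> real \<times> 'd fn" where
  "iterate \<Omega> m p S k l = fst (corrections \<Omega> m S k (fst (fmg_upto \<Omega> m p S (k - 1))) l)"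

definition mg_call :: "(real ^ 'd) set \<Rightarrow> nat \<Rightarrow> nat \<Rightarrow> ('d::finite) fmg \<Rightarrow> nat \<Rightarrow> nat
    \<Rightarrow> 'd fn costed" where
  "mg_call \<Omega> m p S k l =
     (let (lam, u) = iterate \<Omega> m p S k l in MG S (V_h \<Omega> S k) (fscale lam u) u m)"

definition coarse_call :: "(real ^ 'd) set \<Rightarrow> nat \<Rightarrow> nat \<Rightarrow> ('d::finite) fmg \<Rightarrow> nat \<Rightarrow> nat
    \<Rightarrow> (real \<times> 'd fn) costed" where
  "coarse_call \<Omega> m p S k l = eig_solver S (V_Hh \<Omega> S (fst (mg_call \<Omega> m p S k l)))"

text \<open>A run whose meshes form a hierarchy of regular refinements, with nested spaces, and whose
  solvers solve what they should: \<open>eig_solver\<close> returns a normalised eigenpair of every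
  nontrivial subspace, and \<open>mg_step\<close> is a consistent iteration, i.e. the solution of the
  linear problem is a fixed point.\<close>

definition valid_fmg :: "(real ^ 'd) set \<Rightarrow> (real ^ 'd \<Rightarrow> real ^ 'd ^ 'd) \<Rightarrow> ('d::finite) fn
    \<Rightarrow> real \<Rightarrow> nat \<Rightarrow> 'd fmg \<Rightarrow> bool" where
  "valid_fmg \<Omega> A \<phi> \<sigma> \<beta> S \<longleftrightarrow>
     1 \<le> levels S \<and>
     mesh \<Omega> (coarse_mesh S) \<and> shape_regular \<sigma> (coarse_mesh S) \<and>
     (regular_refinement \<Omega> \<beta>)\<^sup>*\<^sup>* (coarse_mesh S) (level_mesh S 1) \<and>
     (\<forall>k\<in>{2..levels S}.
        regular_refinement \<Omega> \<beta> (level_mesh S (k - 1)) (level_mesh S k) \<and>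
        mesh_size (level_mesh S k) = mesh_size (level_mesh S (k - 1)) / \<beta>) \<and>
     V_H \<Omega> S \<subseteq> H1_0 \<Omega> \<and> (\<forall>k\<in>{1..levels S}. V_h \<Omega> S k \<subseteq> H1_0 \<Omega>) \<and>
     V_H \<Omega> S \<subseteq> V_h \<Omega> S 1 \<and> (\<forall>k\<in>{2..levels S}. V_h \<Omega> S (k - 1) \<subset> V_h \<Omega> S k) \<and>
     (\<forall>W. fn.subspace W \<and> W \<subseteq> V_h \<Omega> S (levels S) \<and> W \<noteq> {0} \<longrightarrow>
        eigenpair_in \<Omega> A \<phi> W (fst (eig_solver S W))) \<and>
     (\<forall>k\<in>{2..levels S}. \<forall>g\<in>V_h \<Omega> S k. \<forall>u\<in>V_h \<Omega> S k.
        fst (mg_step S (V_h \<Omega> S k) g u) \<in> V_h \<Omega> S k \<and>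
        ((\<forall>v\<in>V_h \<Omega> S k. form_a \<Omega> A \<phi> u v = form_b \<Omega> g v) \<longrightarrow>
           fst (mg_step S (V_h \<Omega> S k) g u) = u))"

text \<open>In the theorem, a bound with constants that depend neither on the level \<open>k\<close> nor on the
  number of levels is \<open>O[principal I]\<close>: one constant for all elements of the index set \<open>I\<close>.
  Accordingly the dimension relation \<open>N_k = (1/\<beta>)^{d(n-k)} N_n\<close> is required up to
  constants, as \<open>\<Theta>[principal I]\<close>. Exact equality is the special case with both constants equal
  to 1, but it is not available for long hierarchies: a uniform refinement of a plane
  triangulation with \<open>I\<close> interior and \<open>B\<close> boundary vertices and Euler characteristic \<open>\<chi>\<close>
  has \<open>4 I + B - 3 \<chi>\<close> interior vertices.\<close>

end

theory Submission
  imports Defs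
begin

text \<open>The work on level \<open>k\<close> is \<open>O(N\<^sub>k + M\<^sub>H)\<close>. The \<open>N\<^sub>k\<close> grow geometrically, so they sum to
  \<open>O(N\<^sub>n)\<close>, and the coarse solves contribute \<open>(n - 1) M\<^sub>H\<close>. Geometric growth gives
  \<open>n - 1 = O(1 + log N\<^sub>n)\<close>. The additive constant is absorbed because \<open>N\<^sub>n \<ge> 2\<close> for \<open>n \<ge> 2\<close>, which
  follows from the strict nesting of the finite-dimensional spaces.\<close>

section \<open>Dimensions of finite element spaces\<close>

lemma sum_fn_apply: "(\<Sum>i\<in>I. (f i :: 'a \<Rightarrow> real)) x = (\<Sum>i\<in>I. f i x)"
  by (induction I rule: infinite_finite_induct) auto

lemma subspace_linear_fe_space: "fn.subspace (linear_fe_space \<Omega> \<T>)"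
proof (rule fn.subspaceI)
  show "0 \<in> linear_fe_space \<Omega> \<T>"
    by (auto simp: linear_fe_space_def zero_fun_def intro!: exI[of _ 0])
next
  fix u v assume uv: "u \<in> linear_fe_space \<Omega> \<T>" "v \<in> linear_fe_space \<Omega> \<T>"
  have "\<exists>c g. \<forall>x\<in>K. (u + v) x = c + g \<bullet> x" if K: "K \<in> \<T>" for K
  proof -
    from uv K have "\<exists>c g. \<forall>x\<in>K. u x = c + g \<bullet> x" "\<exists>c g. \<forall>x\<in>K. v x = c + g \<bullet> x"
      by (simp_all add: linear_fe_space_def)
    then obtain c g c' g' where "\<forall>x\<in>K. u x = c + g \<bullet> x" "\<forall>x\<in>K. v x = c' + g' \<bullet> x"
      by (elim exE)
    then have "\<forall>x\<in>K. (u + v) x = (c + c') + (g + g') \<bullet> x"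
      by (simp add: inner_add_left)
    then show ?thesis by blast
  qed
  with uv show "u + v \<in> linear_fe_space \<Omega> \<T>"
    by (simp add: linear_fe_space_def plus_fun_def continuous_on_add)
next
  fix r u assume u: "u \<in> linear_fe_space \<Omega> \<T>"
  have "\<exists>c g. \<forall>x\<in>K. fscale r u x = c + g \<bullet> x" if K: "K \<in> \<T>" for K
  proof -
    from u K have "\<exists>c g. \<forall>x\<in>K. u x = c + g \<bullet> x"
      by (simp add: linear_fe_space_def)
    then obtain c g where "\<forall>x\<in>K. u x = c + g \<bullet> x"
      by (elim exE)
    then have "\<forall>x\<in>K. fscale r u x = r * c + (r *\<^sub>R g) \<bullet> x"
      by (simp add: fscale_def distrib_left)
    then show ?thesis by blast
  qed
  with u show "fscale r u \<in> linear_fe_space \<Omega> \<T>"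
    by (simp add: linear_fe_space_def fscale_def continuous_on_mult_left)
qed

text \<open>On one cell a finite element function is fixed by d + 1 coefficients, so the constant 1
  and the coordinates, each cut off to single cells, generate the space. The generators may be
  discontinuous and lie outside the space; what counts is that finitely many suffice, so that strict
  inclusions become strict inequalities of \<open>fn.dim\<close>.\<close>

lemma linear_fe_space_finite_span:
  fixes \<Omega> :: "(real ^ 'd::finite) set"
  assumes "mesh \<Omega> \<T>"
  obtains B where "finite B" "linear_fe_space \<Omega> \<T> \<subseteq> fn.span B"
proof -
  have fin: "finite \<T>" and cover: "\<Union>\<T> = closure \<Omega>"
    using assms by (auto simp: mesh_def triangulation_def)
  \<comment> \<open>Cells share faces; \<open>sel\<close> assigns each point to a single cell.\<close>
  define sel where "sel x = (SOME K. K \<in> \<T> \<and> x \<in> K)" for x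
  have sel: "sel x \<in> \<T> \<and> x \<in> sel x" if "x \<in> \<Omega>" for x
  proof -
    have "\<exists>K. K \<in> \<T> \<and> x \<in> K" using that cover closure_subset by blast
    then show ?thesis unfolding sel_def by (rule someI_ex)
  qed
  define e where "e K = (\<lambda>x. if x \<in> \<Omega> \<and> sel x = K then 1 else 0 :: real)" for K
  define e' where "e' K j = (\<lambda>x. if x \<in> \<Omega> \<and> sel x = K then x $ j else 0 :: real)" for K and j :: 'd
  define B where "B = e ` \<T> \<union> (\<lambda>(K, j). e' K j) ` (\<T> \<times> UNIV)"
  have "finite B" using fin by (simp add: B_def)
  moreover have "u \<in> fn.span B" if u: "u \<in> linear_fe_space \<Omega> \<T>" for u
  proof -
    from u have "\<forall>K\<in>\<T>. \<exists>c g. \<forall>x\<in>K. u x = c + g \<bullet> x"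
      by (simp add: linear_fe_space_def)
    then obtain c g where cg: "\<And>K x. K \<in> \<T> \<Longrightarrow> x \<in> K \<Longrightarrow> u x = c K + g K \<bullet> x"
      by metis
    have "u = (\<Sum>K\<in>\<T>. fscale (c K) (e K) + (\<Sum>j\<in>UNIV. fscale (g K $ j) (e' K j)))"
    proof
      fix x
      show "u x = (\<Sum>K\<in>\<T>. fscale (c K) (e K) + (\<Sum>j\<in>UNIV. fscale (g K $ j) (e' K j))) x"
      proof (cases "x \<in> \<Omega>")
        case False
        then show ?thesis using u
          by (simp add: linear_fe_space_def sum_fn_apply fscale_def e_def e'_def)
      next
        case True
        have "(\<Sum>K\<in>\<T>. fscale (c K) (e K) + (\<Sum>j\<in>UNIV. fscale (g K $ j) (e' K j))) x
            = (\<Sum>K\<in>\<T>. if sel x = K then c K + g K \<bullet> x else 0)"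
          unfolding sum_fn_apply
          by (rule sum.cong)
            (auto simp: sum_fn_apply fscale_def e_def e'_def True inner_vec_def)
        also have "\<dots> = c (sel x) + g (sel x) \<bullet> x"
          using fin sel[OF True] by simp
        also have "\<dots> = u x" using cg[of "sel x" x] sel[OF True] by simp
        finally show ?thesis by simp
      qed
    qed
    also have "\<dots> \<in> fn.span B"
    proof (intro fn.span_sum fn.span_add fn.span_scale fn.span_base)
      show "e K \<in> B" if "K \<in> \<T>" for K using that by (simp add: B_def)
      show "e' K j \<in> B" if "K \<in> \<T>" for K j using that by (force simp: B_def)
    qed
    finally show ?thesis .
  qed
  ultimately show thesis using that by blast
qed

text \<open>A basis of \<open>U\<close> together with one vector of \<open>V\<close> outside
  \<open>U\<close> is still independent, and a finite basis of \<open>V\<close> spans it. Finiteness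
  is essential: \<open>card\<close> of an infinite basis would be 0.\<close>

lemma (in vector_space) dim_strict_mono:
  assumes "subspace U" "U \<subset> V" "finite B" "V \<subseteq> span B"
  shows "dim U < dim V"
proof -
  obtain BU where BU: "BU \<subseteq> U" "independent BU" "U \<subseteq> span BU" "card BU = dim U"
    using basis_exists by blast
  obtain BV where BV: "BV \<subseteq> V" "independent BV" "V \<subseteq> span BV" "card BV = dim V"
    using basis_exists by blast
  have finV: "finite BV"
    using independent_span_bound[OF \<open>finite B\<close> BV(2)] BV(1) assms(4) by blast
  obtain v where v: "v \<in> V" "v \<notin> U" using assms(2) by blast
  have "v \<notin> span BU" using span_minimal[OF BU(1) assms(1)] v(2) by blast
  moreover from this have "v \<notin> BU" using span_base by blast
  ultimately have "independent (insert v BU)" using BU(2) by (simp add: independent_insert)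
  moreover have "insert v BU \<subseteq> span BV" using BU(1) BV(3) v(1) assms(2) by blast
  ultimately have "finite (insert v BU)" "card (insert v BU) \<le> card BV"
    using independent_span_bound[OF finV, of "insert v BU"] by simp_all
  with \<open>v \<notin> BU\<close> show ?thesis using BU(4) BV(4) by simp
qed

lemma N_dof_strict_mono:
  assumes "valid_fmg \<Omega> A \<phi> \<sigma> \<beta> S" "k \<in> {2..levels S}"
  shows "N_dof \<Omega> S (k - 1) < N_dof \<Omega> S k"
proof -
  have "mesh \<Omega> (level_mesh S k)" and ss: "V_h \<Omega> S (k - 1) \<subset> V_h \<Omega> S k"
    using assms by (auto simp: valid_fmg_def regular_refinement_def)
  then obtain B where "finite B" "V_h \<Omega> S k \<subseteq> fn.span B"
    using linear_fe_space_finite_span unfolding V_h_def by metis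
  then show ?thesis
    unfolding N_dof_def
    using fn.dim_strict_mono[OF _ ss] by (simp add: V_h_def subspace_linear_fe_space)
qed

section \<open>Work of the scheme\<close>

lemma work_corrections:
  "snd (corrections \<Omega> m S k r q) =
     (\<Sum>l<q. snd (EigenMG \<Omega> m S k (fst (corrections \<Omega> m S k r l))))"
proof (induction q)
  case (Suc q)
  have "snd (corrections \<Omega> m S k r (Suc q)) = snd (corrections \<Omega> m S k r q)
      + snd (EigenMG \<Omega> m S k (fst (corrections \<Omega> m S k r q)))"
    by (simp only: corrections.simps Let_def split_beta fst_conv snd_conv)
  with Suc show ?case by (simp only: sum.lessThan_Suc)
qed simp

lemma work_EigenMG_iterate:
  "snd (EigenMG \<Omega> m S k (iterate \<Omega> m p S k l)) =
     snd (mg_call \<Omega> m p S k l) + snd (coarse_call \<Omega> m p S k l)"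
  by (simp only: EigenMG_def mg_call_def coarse_call_def Let_def split_beta fst_conv snd_conv)

text \<open>This turns the recursively accumulated cost into a sum over exactly those calls that the
  work assumptions on the solvers speak of.\<close>

lemma work_fmg_upto:
  assumes "1 \<le> n"
  shows "snd (fmg_upto \<Omega> m p S n) = snd (eig_solver S (V_h \<Omega> S 1)) +
     (\<Sum>k=2..n. \<Sum>l<p. snd (mg_call \<Omega> m p S k l) + snd (coarse_call \<Omega> m p S k l))"
  using assms
proof (induction n rule: dec_induct)
  case base
  show ?case by (subst fmg_upto.simps) simp
next
  case (step n)
  have "snd (fmg_upto \<Omega> m p S (Suc n)) = snd (fmg_upto \<Omega> m p S n) +
      (\<Sum>l<p. snd (EigenMG \<Omega> m S (Suc n) (iterate \<Omega> m p S (Suc n) l)))"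
  proof -
    have "\<not> Suc n \<le> 1" using step.hyps by simp
    then show ?thesis
      by (subst fmg_upto.simps) (simp only: if_False Let_def split_beta fst_conv snd_conv
        work_corrections iterate_def diff_Suc_1)
  qed
  with step show ?case by (simp add: work_EigenMG_iterate del: corrections.simps)
qed

section \<open>Geometric growth of dimensions and the number of levels\<close>

lemma geometric_sum_le_2:
  fixes q :: real
  assumes "0 \<le> q" "q \<le> 1/2"
  shows "(\<Sum>k=2..n. q ^ (n - k)) \<le> 2"
proof (induction n)
  case (Suc n)
  have "(\<Sum>k=2..Suc n. q ^ (Suc n - k)) \<le> 1 + q * (\<Sum>k=2..n. q ^ (n - k))"
  proof (cases "2 \<le> Suc n")
    case True
    have "(\<Sum>k=2..n. q ^ (Suc n - k)) = q * (\<Sum>k=2..n. q ^ (n - k))"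
      unfolding sum_distrib_left by (rule sum.cong) (auto simp: Suc_diff_le)
    with True show ?thesis by simp
  qed auto
  \<comment> \<open>The bound 2 reproduces itself in the induction, since 1 + 2/2 = 2.\<close>
  also have "\<dots> \<le> 1 + (1/2) * 2"
    using assms Suc by (intro add_left_mono mult_mono) (auto intro!: sum_nonneg)
  finally show ?case by simp
qed simp

text \<open>Taking logarithms gives j ln q \<le> ln C + ln N. Since N \<ge> 2, the factor ln N / ln
  2 is at least 1, so multiplying the constant by it absorbs the constant into ln N. The absolute
  value keeps that constant nonnegative when C < 1.\<close>

lemma levels_le_ln:
  fixes N q C :: real
  assumes "1 < q" "0 < C" "2 \<le> N" "q ^ j \<le> C * N"
  shows "real j \<le> (1 + \<bar>ln C\<bar> / ln 2) / ln q * ln N"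
proof -
  have "real j * ln q = ln (q ^ j)" using assms by (simp add: ln_realpow)
  also have "\<dots> \<le> ln (C * N)" using assms by (subst ln_le_cancel_iff) auto
  also have "\<dots> \<le> \<bar>ln C\<bar> * 1 + ln N" using assms by (simp add: ln_mult)
  also have "\<dots> \<le> \<bar>ln C\<bar> * (ln N / ln 2) + ln N"
    using assms by (intro add_right_mono mult_left_mono) auto
  finally show ?thesis using assms by (simp add: field_simps)
qed

section \<open>Uniform constants from Landau symbols over principal filters\<close>

lemma bigo_principalE:
  assumes "f \<in> O[principal I](g)"
  obtains c where "0 < c" "\<And>i. i \<in> I \<Longrightarrow> norm (f i) \<le> c * norm (g i)"
  using assms by (auto simp: eventually_principal elim!: landau_o.bigE)

lemma bigo_principal2E:
  assumes "(\<lambda>(x, y). f x y) \<in> O[principal {(x, y). P x y}](\<lambda>(x, y). g x y)"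
  obtains c where "0 < c" "\<And>x y. P x y \<Longrightarrow> norm (f x y) \<le> c * norm (g x y)"
  using assms by (elim bigo_principalE) force

lemma bigo_principal3E:
  assumes "(\<lambda>(x, y, z). f x y z) \<in> O[principal {(x, y, z). P x y z}](\<lambda>(x, y, z). g x y z)"
  obtains c where "0 < c" "\<And>x y z. P x y z \<Longrightarrow> norm (f x y z) \<le> c * norm (g x y z)"
  using assms by (elim bigo_principalE) force

lemma bigo_principalI:
  assumes "\<And>i. i \<in> I \<Longrightarrow> norm (f i) \<le> c * norm (g i)"
  shows "f \<in> O[principal I](g)"
\<comment> \<open>A Landau constant must be positive, whereas \<open>c\<close> may have any
  sign.\<close>
proof (intro landau_o.bigI[of "max c 1"])
  have "norm (f i) \<le> max c 1 * norm (g i)" if "i \<in> I" for i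
    using assms[OF that] by (rule order.trans) (simp add: mult_right_mono)
  then show "\<forall>\<^sub>F i in principal I. norm (f i) \<le> max c 1 * norm (g i)"
    by (simp add: eventually_principal)
qed simp

theorem theorem3p3:
  fixes \<Omega> :: "(real ^ 'd::finite) set"
    and A :: "real ^ 'd \<Rightarrow> real ^ 'd ^ 'd"
    and \<phi> :: "real ^ 'd \<Rightarrow> real"
    and \<sigma> :: real and \<beta> m p :: nat
    and F :: "'d fmg set"
    and M_H M_h1 :: "'d fmg \<Rightarrow> real"
  assumes dimension: "CARD('d) = 2 \<or> CARD('d) = 3"
    and domain: "bounded_lipschitz_domain \<Omega>"
    and coefficients: "admissible_coefficients \<Omega> A \<phi>"
    and sigma: "0 < \<sigma>" and beta: "1 < \<beta>"
    and valid: "\<And>S. S \<in> F \<Longrightarrow> valid_fmg \<Omega> A \<phi> \<sigma> \<beta> S"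
    and nonneg: "\<And>S. S \<in> F \<Longrightarrow> 0 \<le> M_H S \<and> 0 \<le> M_h1 S"
    and dims: "(\<lambda>(S, k). real (N_dof \<Omega> S k))
        \<in> \<Theta>[principal {(S, k). S \<in> F \<and> 1 \<le> k \<and> k \<le> levels S}](
            \<lambda>(S, k). (1 / real \<beta>) ^ (CARD('d) * (levels S - k)) * real (N_dof \<Omega> S (levels S)))"
    and work_H: "(\<lambda>S. real (snd (eig_solver S (V_H \<Omega> S)))) \<in> O[principal F](M_H)"
    and work_Hh: "(\<lambda>(S, k, l). real (snd (coarse_call \<Omega> m p S k l)))
        \<in> O[principal {(S, k, l). S \<in> F \<and> 2 \<le> k \<and> k \<le> levels S \<and> l < p}](\<lambda>(S, k, l). M_H S)"
    and work_h1: "(\<lambda>S. real (snd (eig_solver S (V_h \<Omega> S 1)))) \<in> O[principal F](M_h1)"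
    and work_MG: "(\<lambda>(S, k, l). real (snd (mg_call \<Omega> m p S k l)))
        \<in> O[principal {(S, k, l). S \<in> F \<and> 2 \<le> k \<and> k \<le> levels S \<and> l < p}](
            \<lambda>(S, k, l). real (N_dof \<Omega> S k))"
  shows "((\<lambda>S. real (fmg_work \<Omega> m p S)) \<in> O[principal F](
            \<lambda>S. real (N_dof \<Omega> S (levels S)) + M_H S * ln (real (N_dof \<Omega> S (levels S))) + M_h1 S)) \<and>
        ((\<forall>S\<in>F. 2 \<le> levels S \<and>
            (\<forall>k\<in>{2..levels S}. M_H S \<le> real (N_dof \<Omega> S k) \<and> M_h1 S \<le> real (N_dof \<Omega> S k)))
         \<longrightarrow> (\<lambda>S. real (fmg_work \<Omega> m p S)) \<in> O[principal F](\<lambda>S. real (N_dof \<Omega> S (levels S))))"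
proof -
  let ?n = levels
  let ?N = "\<lambda>S k. real (N_dof \<Omega> S k)"
  \<comment> \<open>The growth factor of the dimension per refinement. From \<beta> \<ge> 2 it
    follows that 1/q \<le> 1/2, as \<open>geometric_sum_le_2\<close> requires.\<close>
  define q where "q = real \<beta> ^ CARD('d)"
  have "real \<beta> ^ 1 \<le> q" unfolding q_def
    using beta dimension by (intro power_increasing) auto
  with beta have q: "2 \<le> q" by simp
  have qpow: "(1 / real \<beta>) ^ (CARD('d) * j) = (1 / q) ^ j" for j
    by (simp add: q_def power_mult power_one_over)
  obtain c1 where "0 < c1" and c1: "\<And>S k. S \<in> F \<Longrightarrow> 1 \<le> k \<Longrightarrow> k \<le> ?n S \<Longrightarrow>
      ?N S k \<le> c1 * ((1 / q) ^ (?n S - k) * ?N S (?n S))"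
    by (rule bigo_principal2E[OF bigthetaD1[OF dims]]) (use q in \<open>simp add: qpow abs_mult\<close>)
  \<comment> \<open>The lower half of the dimension relation; it serves to carry positivity of the
    dimension from the finest level to all others.\<close>
  obtain c0 where "0 < c0" and c0: "\<And>S k. S \<in> F \<Longrightarrow> 1 \<le> k \<Longrightarrow> k \<le> ?n S \<Longrightarrow>
      (1 / q) ^ (?n S - k) * ?N S (?n S) \<le> c0 * ?N S k"
    by (rule bigo_principal2E[OF bigthetaD2[OF dims, unfolded bigomega_iff_bigo]])
      (use q in \<open>simp add: qpow abs_mult\<close>)
  obtain cH where "0 < cH" and cH: "\<And>S k l. S \<in> F \<Longrightarrow> 2 \<le> k \<Longrightarrow> k \<le> ?n S \<Longrightarrow> l < p \<Longrightarrow>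
      real (snd (coarse_call \<Omega> m p S k l)) \<le> cH * M_H S"
    by (rule bigo_principal3E[OF work_Hh]) (use nonneg in simp)
  obtain ch where "0 < ch" and ch: "\<And>S. S \<in> F \<Longrightarrow>
      real (snd (eig_solver S (V_h \<Omega> S 1))) \<le> ch * M_h1 S"
    by (rule bigo_principalE[OF work_h1]) (use nonneg in simp)
  obtain cM where "0 < cM" and cM: "\<And>S k l. S \<in> F \<Longrightarrow> 2 \<le> k \<Longrightarrow> k \<le> ?n S \<Longrightarrow> l < p \<Longrightarrow>
      real (snd (mg_call \<Omega> m p S k l)) \<le> cM * ?N S k"
    by (rule bigo_principal3E[OF work_MG]) simp

  have sumN: "(\<Sum>k=2..?n S. ?N S k) \<le> 2 * c1 * ?N S (?n S)" if S: "S \<in> F" for S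
  proof -
    have "(\<Sum>k=2..?n S. ?N S k) \<le> (\<Sum>k=2..?n S. c1 * ?N S (?n S) * (1 / q) ^ (?n S - k))"
      using c1[OF S] by (intro sum_mono) (fastforce simp: mult_ac)
    also have "\<dots> = c1 * ?N S (?n S) * (\<Sum>k=2..?n S. (1 / q) ^ (?n S - k))"
      by (simp add: sum_distrib_left)
    also have "\<dots> \<le> c1 * ?N S (?n S) * 2"
      using \<open>0 < c1\<close> q by (intro mult_left_mono geometric_sum_le_2) (auto simp: field_simps)
    finally show ?thesis by simp
  qed
  have levels: "1 \<le> ?n S" if "S \<in> F" for S
    using valid[OF that] by (simp add: valid_fmg_def)
  have work: "real (fmg_work \<Omega> m p S) \<le> ch * M_h1 S + p * cM * (\<Sum>k=2..?n S. ?N S k)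
      + p * cH * (real (?n S - 1) * M_H S)" if S: "S \<in> F" for S
  proof -
    have "real (fmg_work \<Omega> m p S) = real (snd (eig_solver S (V_h \<Omega> S 1))) + (\<Sum>k=2..?n S. \<Sum>l<p.
        real (snd (mg_call \<Omega> m p S k l)) + real (snd (coarse_call \<Omega> m p S k l)))"
      using work_fmg_upto[OF levels[OF S], of \<Omega> m p S] by (simp add: fmg_work_def full_multigrid_def)
    also have "\<dots> \<le> ch * M_h1 S + (\<Sum>k=2..?n S. \<Sum>l<p. cM * ?N S k + cH * M_H S)"
      using S by (intro add_mono sum_mono ch cM cH) auto
    also have "\<dots> = ch * M_h1 S + p * cM * (\<Sum>k=2..?n S. ?N S k) + p * cH * (real (?n S - 1) * M_H S)"
      using levels[OF S]
      by (simp add: sum.distrib sum_distrib_left algebra_simps of_nat_diff)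
    finally show ?thesis .
  qed

  \<comment> \<open>The constant of \<open>levels_le_ln\<close> for the estimate q^(n-1) \<le> c1
    N_n proved below.\<close>
  define cl where "cl = (1 + \<bar>ln c1\<bar> / ln 2) / ln q"
  have "0 \<le> cl" using q by (simp add: cl_def)
  have ln_bound: "real (?n S - 1) \<le> cl * ln (?N S (?n S))" if S: "S \<in> F" for S
  proof (cases "?n S = 1")
    case True
    \<comment> \<open>With a single level the dimension may be 0; the convention ln 0 = 0 covers
      this.\<close>
    then show ?thesis using \<open>0 \<le> cl\<close> by (cases "N_dof \<Omega> S 1") auto
  next
    case False
    with levels[OF S] have n: "2 \<le> ?n S" by simp
    have less: "N_dof \<Omega> S (?n S - 1) < N_dof \<Omega> S (?n S)"
      using N_dof_strict_mono[OF valid[OF S]] n by simp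
    \<comment> \<open>Strict nesting makes the finest dimension positive, and \<open>c0\<close>
      passes this on to every level.\<close>
    then have "0 < (1 / q) ^ (?n S - k) * ?N S (?n S)" for k using q by simp
    then have pos: "1 \<le> N_dof \<Omega> S k" if "1 \<le> k" "k \<le> ?n S" for k
      using c0[OF S that] by (cases "N_dof \<Omega> S k") (auto simp: not_le dest: leD)
    \<comment> \<open>The last but one dimension is at least 1, and the last one is strictly
      larger.\<close>
    have "2 \<le> ?N S (?n S)"
      using pos[of "?n S - 1"] n less by linarith
    moreover have "q ^ (?n S - 1) \<le> c1 * ?N S (?n S)"
    proof -
      have "1 \<le> ?N S 1" using pos[of 1] n by simp
      also have "\<dots> \<le> c1 * ((1 / q) ^ (?n S - 1) * ?N S (?n S))" using c1[OF S, of 1] n by simp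
      finally show ?thesis using q by (simp add: field_simps)
    qed
    ultimately show ?thesis
      unfolding cl_def using q \<open>0 < c1\<close> by (intro levels_le_ln) auto
  qed

  \<comment> \<open>The sum of the three nonnegative coefficients below dominates each of
    them.\<close>
  define c where "c = ch + p * cM * (2 * c1) + p * cH * cl"
  have "(\<lambda>S. real (fmg_work \<Omega> m p S)) \<in> O[principal F](
      \<lambda>S. ?N S (?n S) + M_H S * ln (?N S (?n S)) + M_h1 S)"
  proof (rule bigo_principalI)
    fix S assume S: "S \<in> F"
    have ln0: "0 \<le> ln (?N S (?n S))" by (cases "N_dof \<Omega> S (?n S)") auto
    note nn = nonneg[OF S]
    have "real (fmg_work \<Omega> m p S) \<le> ch * M_h1 S + p * cM * (2 * c1 * ?N S (?n S))
        + p * cH * (cl * ln (?N S (?n S)) * M_H S)"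
      using \<open>0 < cM\<close> \<open>0 < cH\<close> nn
      by (intro order.trans[OF work[OF S]] add_mono order.refl mult_left_mono mult_right_mono
          sumN[OF S] ln_bound[OF S]) auto
    also have "\<dots> = ch * M_h1 S + p * cM * (2 * c1) * ?N S (?n S)
        + p * cH * cl * (M_H S * ln (?N S (?n S)))"
      by (simp add: mult_ac)
    also have "\<dots> \<le> c * M_h1 S + c * ?N S (?n S) + c * (M_H S * ln (?N S (?n S)))"
      using \<open>0 < ch\<close> \<open>0 < cM\<close> \<open>0 < c1\<close> \<open>0 < cH\<close> \<open>0 \<le> cl\<close> nn ln0
      by (intro add_mono mult_right_mono) (auto simp: c_def)
    finally show "norm (real (fmg_work \<Omega> m p S)) \<le> c * norm (?N S (?n S) + M_H S * ln (?N S (?n S)) + M_h1 S)"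
      using nn ln0 by (simp add: algebra_simps)
  qed
  moreover have "(\<lambda>S. real (fmg_work \<Omega> m p S)) \<in> O[principal F](\<lambda>S. ?N S (?n S))"
    if small: "\<forall>S\<in>F. 2 \<le> ?n S \<and> (\<forall>k\<in>{2..?n S}. M_H S \<le> ?N S k \<and> M_h1 S \<le> ?N S k)"
  proof (rule bigo_principalI)
    fix S assume S: "S \<in> F"
    \<comment> \<open>No logarithm arises here: the n - 1 copies of \<open>M_H S\<close> are
      compared level by level with the N_k, whose sum is already O(N_n).\<close>
    have "real (?n S - 1) * M_H S = (\<Sum>k=2..?n S. M_H S)"
      using levels[OF S] by (simp add: of_nat_diff)
    also have "\<dots> \<le> (\<Sum>k=2..?n S. ?N S k)" using small S by (intro sum_mono) auto
    also note sumN[OF S]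
    finally have MH: "real (?n S - 1) * M_H S \<le> 2 * c1 * ?N S (?n S)" .
    \<comment> \<open>This takes k = n, which lies in the range because there are at least two
      levels.\<close>
    have Mh1: "M_h1 S \<le> ?N S (?n S)" using small S by auto
    have "real (fmg_work \<Omega> m p S) \<le> ch * ?N S (?n S) + p * cM * (2 * c1 * ?N S (?n S))
        + p * cH * (2 * c1 * ?N S (?n S))"
      using \<open>0 < cM\<close> \<open>0 < cH\<close> \<open>0 < ch\<close>
      by (intro order.trans[OF work[OF S]] add_mono mult_left_mono sumN[OF S] MH Mh1) auto
    then show "norm (real (fmg_work \<Omega> m p S)) \<le>
        (ch + p * cM * (2 * c1) + p * cH * (2 * c1)) * norm (?N S (?n S))"
      by (simp add: algebra_simps)
  qed
  ultimately show ?thesis by blast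
qed

end
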